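(* Let $G=(V,E)$ be a graph with at least one edge, let $t\ge 1$ be an integer, and let $L(G)$ be its line graph with adjacency matrix $A'$ and adjacency eigenvalues $\lambda'_1\ge\lambda'_2\ge\cdots\ge\lambda'_m$, where $m=|E|$. Let $p\in\mathbb{R}_t[x]$ and set $W'(p):=\max_{e\in E}(p(A'))_{ee}$ and $w'(p):=\min_{e\in E}(p(A'))_{ee}$. Then $$\chi'_t(G)\ \ge\ \frac{|E|}{\min\bigl\{\,|\{i: p(\lambda'_i)\ge w'(p)\}|,\ |\{i: p(\lambda'_i)\le W'(p)\}|\,\bigr\}}.$$
   Context: All graphs are finite, simple and undirected. The line graph $L(G)$ has vertex set $E$, two edges being adjacent iff they share an endpoint. The distance between two edges of $G$ is their distance in $L(G)$ (equivalently, the number of vertices in a shortest path between them; incident edges have distance $1$). A distance-$t$ edge-colouring assigns colours to the edges so that any two distinct edges at distance at most $t$ receive distinct colours; $\chi'_t(G)$ is the least number of colours in such a colouring (equivalently, the chromatic number of the $t$-th power $L(G)^t$). $\mathbb{R}_t[x]$ denotes the real polynomials of degree at most $t$. *)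

theory Defs
  imports
    Complex_Main
    "HOL-Library.Extended_Nat"
    "HOL-Library.Multiset"
    "HOL-Computational_Algebra.Polynomial"
    "Jordan_Normal_Form.Char_Poly"
begin

definition simple_graph :: "'a set \<Rightarrow> 'a set set \<Rightarrow> bool" where
  "simple_graph V E \<longleftrightarrow> finite V \<and> (\<forall>e\<in>E. e \<subseteq> V \<and> card e = 2)"

text \<open>The line graph of \<open>(V, E)\<close> is the graph \<open>(E, line_edges E)\<close>.\<close>

definition line_edges :: "'a set set \<Rightarrow> 'a set set set" where
  "line_edges E = {{e, f} | e f. e \<in> E \<and> f \<in> E \<and> e \<noteq> f \<and> e \<inter> f \<noteq> {}}"

text \<open>Paths are lists of vertices; a path given by \<open>xs\<close> has \<open>length xs - 1\<close> edges.\<close>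

definition is_path :: "'a set \<Rightarrow> 'a set set \<Rightarrow> 'a \<Rightarrow> 'a list \<Rightarrow> 'a \<Rightarrow> bool" where
  "is_path V E u xs v \<longleftrightarrow>
     xs \<noteq> [] \<and> hd xs = u \<and> last xs = v \<and> set xs \<subseteq> V \<and> distinct xs \<and>
     (\<forall>i. Suc i < length xs \<longrightarrow> {xs ! i, xs ! Suc i} \<in> E)"

text \<open>Vertices in different components are at distance \<open>\<infinity>\<close>, the infimum of the empty set.\<close>

definition graph_dist :: "'a set \<Rightarrow> 'a set set \<Rightarrow> 'a \<Rightarrow> 'a \<Rightarrow> enat" where
  "graph_dist V E u v = (INF xs \<in> {xs. is_path V E u xs v}. enat (length xs - 1))"

definition edge_dist :: "'a set set \<Rightarrow> 'a set \<Rightarrow> 'a set \<Rightarrow> enat" where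
  "edge_dist E e f = graph_dist E (line_edges E) e f"

definition distance_edge_colouring :: "'a set set \<Rightarrow> nat \<Rightarrow> ('a set \<Rightarrow> 'c) \<Rightarrow> bool" where
  "distance_edge_colouring E t c \<longleftrightarrow>
     (\<forall>e\<in>E. \<forall>f\<in>E. e \<noteq> f \<and> edge_dist E e f \<le> enat t \<longrightarrow> c e \<noteq> c f)"

definition distance_chromatic_index :: "'a set set \<Rightarrow> nat \<Rightarrow> nat" where
  "distance_chromatic_index E t =
     (LEAST k. \<exists>c :: 'a set \<Rightarrow> nat. c ` E \<subseteq> {..<k} \<and> distance_edge_colouring E t c)"

text \<open>The list \<open>vs\<close> enumerates the vertices of the graph and fixes the order of rows and columns.\<close>

definition adjacency_matrix :: "'a list \<Rightarrow> 'a set set \<Rightarrow> real mat" where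
  "adjacency_matrix vs E =
     mat (length vs) (length vs) (\<lambda>(i, j). if {vs ! i, vs ! j} \<in> E then 1 else 0)"

text \<open>
  The real eigenvalues, repeated according to algebraic multiplicity, in nonincreasing order.
  For a real symmetric matrix these are all the eigenvalues, so the list has length \<open>dim_row A\<close>.
\<close>

definition eigenvalue_list :: "real mat \<Rightarrow> real list" where
  "eigenvalue_list A = rev (sorted_list_of_multiset (proots (char_poly A)))"

definition poly_mat :: "real poly \<Rightarrow> real mat \<Rightarrow> real mat" where
  "poly_mat p A = mat (dim_row A) (dim_row A)
     (\<lambda>(i, j). \<Sum>k\<le>degree p. coeff p k * (A ^\<^sub>m k) $$ (i, j))"

definition max_diag :: "real mat \<Rightarrow> real" where
  "max_diag M = Max {M $$ (i, i) | i. i < dim_row M}"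

definition min_diag :: "real mat \<Rightarrow> real" where
  "min_diag M = Min {M $$ (i, i) | i. i < dim_row M}"

end

theory Submission
  imports Defs "Jordan_Normal_Form.Spectral_Radius"
begin

text \<open>
  A colour class \<open>S\<close> consists of edges at pairwise distance greater than \<open>t\<close>, and entries of powers
  of \<open>A'\<close> count walks, so the principal submatrix of \<open>p(A')\<close> on \<open>S\<close> is diagonal with entries in
  \<open>[w', W']\<close>. By interlacing, \<open>p(A')\<close> has at least \<open>|S|\<close> eigenvalues \<open>\<ge> w'\<close> and at least
  \<open>|S|\<close> eigenvalues \<open>\<le> W'\<close>. This bounds every colour class, hence the number of colours.
\<close>

section \<open>The spectral theorem for real symmetric matrices\<close>

definition orthogonally_similar :: "'a :: comm_semiring_1 mat \<Rightarrow> 'a mat \<Rightarrow> bool" where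
  "orthogonally_similar A B \<longleftrightarrow> (\<exists>P. similar_mat_wit A B P P\<^sup>T)"

lemma orthogonally_similar_imp_similar_mat: "orthogonally_similar A B \<Longrightarrow> similar_mat A B"
  by (auto simp: orthogonally_similar_def similar_mat_def)

lemma orthogonally_similar_refl:
  "A \<in> carrier_mat n n \<Longrightarrow> orthogonally_similar A A"
  unfolding orthogonally_similar_def
  by (rule exI[of _ "1\<^sub>m n"]) (simp add: similar_mat_wit_refl)

lemma orthogonally_similar_trans:
  assumes AB: "orthogonally_similar A B" and BC: "orthogonally_similar B C"
  shows "orthogonally_similar A C"
proof -
  obtain P Q where P: "similar_mat_wit A B P P\<^sup>T" and Q: "similar_mat_wit B C Q Q\<^sup>T"
    using AB BC unfolding orthogonally_similar_def by blast
  have "similar_mat_wit A C (P * Q) (Q\<^sup>T * P\<^sup>T)"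
    using P Q by (rule similar_mat_wit_trans)
  also have "Q\<^sup>T * P\<^sup>T = (P * Q)\<^sup>T"
    using similar_mat_witD[OF refl P] similar_mat_witD[OF refl Q]
    by (metis carrier_matD(1) transpose_mult)
  finally show ?thesis
    unfolding orthogonally_similar_def by blast
qed

lemma transpose_congruence:
  fixes A W :: "'a :: comm_semiring_1 mat"
  assumes A: "A \<in> carrier_mat n n" and W: "W \<in> carrier_mat n k"
  shows "(W\<^sup>T * A * W)\<^sup>T = W\<^sup>T * A\<^sup>T * W"
proof -
  have "(W\<^sup>T * A * W)\<^sup>T = W\<^sup>T * (W\<^sup>T * A)\<^sup>T"
    using A W by (intro transpose_mult[of _ k n]) auto
  also have "(W\<^sup>T * A)\<^sup>T = A\<^sup>T * W"
    using A W by (subst transpose_mult[of _ k n]) auto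
  finally show ?thesis
    using A W by (simp add: assoc_mult_mat[of "W\<^sup>T" k n "A\<^sup>T" n])
qed

lemma orthogonally_similar_mat_diag_imp_symmetric:
  assumes "orthogonally_similar A (mat_diag n d)"
  shows "A\<^sup>T = A"
proof -
  obtain P where sim: "similar_mat_wit A (mat_diag n d) P P\<^sup>T"
    using assms unfolding orthogonally_similar_def by blast
  note wit = similar_mat_witD[OF refl sim]
  have "dim_row A = n"
    using wit(5) mat_diag_dim by (metis carrier_matD(1))
  then have P: "P\<^sup>T \<in> carrier_mat n n"
    using wit(6) by simp
  have A: "(P\<^sup>T)\<^sup>T * mat_diag n d * P\<^sup>T = A"
    using wit(3) by simp
  have "(mat_diag n d)\<^sup>T = mat_diag n d"
    by (rule eq_matI) (auto simp: mat_diag_def)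
  then show ?thesis
    using transpose_congruence[OF mat_diag_dim P, of d] by (simp only: A)
qed

lemma orthogonally_similar_conjugation:
  fixes A W :: "'a :: field mat"
  assumes A: "A \<in> carrier_mat n n" and W: "W \<in> carrier_mat n n" "W\<^sup>T * W = 1\<^sub>m n"
  shows "orthogonally_similar A (W\<^sup>T * A * W)"
proof -
  have WT: "W * W\<^sup>T = 1\<^sub>m n"
    using W by (intro mat_mult_left_right_inverse[of "W\<^sup>T"]) auto
  have "similar_mat_wit (W\<^sup>T * A * W) A W\<^sup>T W"
    by (rule similar_mat_witI[OF W(2) WT]) (use A W(1) in auto)
  then show ?thesis
    unfolding orthogonally_similar_def using similar_mat_wit_sym by blast
qed

lemma orthogonally_similar_four_block:
  assumes sim: "orthogonally_similar A B" "orthogonally_similar C D"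
    and A: "A \<in> carrier_mat n n" and C: "C \<in> carrier_mat m m"
  shows "orthogonally_similar
    (four_block_mat A (0\<^sub>m n m) (0\<^sub>m m n) C) (four_block_mat B (0\<^sub>m n m) (0\<^sub>m m n) D)"
proof -
  obtain P Q where P: "similar_mat_wit A B P P\<^sup>T" and Q: "similar_mat_wit C D Q Q\<^sup>T"
    using sim unfolding orthogonally_similar_def by blast
  note carrier = similar_mat_witD2[OF A P] similar_mat_witD2[OF C Q]
  let ?R = "four_block_mat P (0\<^sub>m n m) (0\<^sub>m m n) Q"
  have "?R\<^sup>T = four_block_mat P\<^sup>T (0\<^sub>m n m) (0\<^sub>m m n) Q\<^sup>T"
    using carrier by (subst transpose_four_block_mat) auto
  moreover have "similar_mat_wit
      (four_block_mat A (0\<^sub>m n m) (0\<^sub>m m n) C) (four_block_mat B (0\<^sub>m n m) (0\<^sub>m m n) D)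
      ?R (four_block_mat P\<^sup>T (0\<^sub>m n m) (0\<^sub>m m n) Q\<^sup>T)"
    by (rule similar_mat_wit_four_block[OF P Q _ _ A C]) (use carrier in auto)
  ultimately show ?thesis
    unfolding orthogonally_similar_def by metis
qed

lemma adjoint_cscalar_prod:
  fixes A :: "'a :: conjugatable_field mat"
  assumes A: "A \<in> carrier_mat nr nc" and x: "x \<in> carrier_vec nc" and y: "y \<in> carrier_vec nr"
  shows "(A *\<^sub>v x) \<bullet>c y = x \<bullet>c (mat_adjoint A *\<^sub>v y)"
proof -
  have adjoint: "conjugate (mat_adjoint A *\<^sub>v y) = A\<^sup>T *\<^sub>v conjugate y"
  proof (rule eq_vecI)
    fix i assume "i < dim_vec (A\<^sup>T *\<^sub>v conjugate y)"
    then have i: "i < nc" using A by simp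
    have "conjugate (conjugate (col A i) \<bullet> y) = col A i \<bullet>c y"
      using A y by (intro conjugate_conjugate_sprod) auto
    then show "conjugate (mat_adjoint A *\<^sub>v y) $ i = (A\<^sup>T *\<^sub>v conjugate y) $ i"
      using A i by (simp add: mat_adjoint_def)
  qed (use A in \<open>simp add: mat_adjoint_def\<close>)
  have "(A *\<^sub>v x) \<bullet>c y = conjugate y \<bullet> (A *\<^sub>v x)"
    using A x y by (intro comm_scalar_prod[of _ nr]) auto
  also have "\<dots> = (A\<^sup>T *\<^sub>v conjugate y) \<bullet> x"
    using A x y by (intro transpose_vec_mult_scalar[symmetric]) auto
  also have "\<dots> = x \<bullet> (A\<^sup>T *\<^sub>v conjugate y)"
    using A x y by (intro comm_scalar_prod[of _ nc]) auto
  finally show ?thesis unfolding adjoint .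
qed

lemma hermitian_eigenvalue_conjugate:
  fixes A :: "'a :: conjugatable_ordered_field mat"
  assumes A: "A \<in> carrier_mat n n" and hermitian: "mat_adjoint A = A" and z: "eigenvalue A z"
  shows "conjugate z = z"
proof -
  obtain v where v: "v \<in> carrier_vec n" "v \<noteq> 0\<^sub>v n" "A *\<^sub>v v = z \<cdot>\<^sub>v v"
    using z A unfolding eigenvalue_def eigenvector_def by auto
  have "z * (v \<bullet>c v) = (A *\<^sub>v v) \<bullet>c v"
    using v by simp
  also have "\<dots> = v \<bullet>c (A *\<^sub>v v)"
    using adjoint_cscalar_prod[OF A v(1,1)] unfolding hermitian .
  also have "\<dots> = conjugate z * (v \<bullet>c v)"
    using v by (simp add: conjugate_smult_vec)
  finally show ?thesis
    using v(1,2) by simp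
qed

lemma real_symmetric_has_eigenvalue:
  fixes A :: "real mat"
  assumes A: "A \<in> carrier_mat n n" and sym: "A\<^sup>T = A" and n: "n > 0"
  obtains k where "eigenvalue A k"
proof -
  let ?C = "map_mat complex_of_real A"
  have C: "?C \<in> carrier_mat n n" using A by simp
  obtain z where z: "eigenvalue ?C z"
    using spectrum_non_empty[OF C n] unfolding spectrum_def by blast
  have "A $$ (i, j) = A $$ (j, i)" if "i < n" "j < n" for i j
    using sym A that by (metis carrier_matD index_transpose_mat(1))
  then have "mat_adjoint ?C = ?C"
    using A by (intro eq_matI) (auto simp: mat_adjoint_def mat_of_rows_index)
  then have "cnj z = z"
    using hermitian_eigenvalue_conjugate[OF C _ z] by simp
  then have "complex_of_real (Re z) = z"
    by (metis Reals_cnj_iff of_real_Re)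
  then have "poly (map_poly complex_of_real (char_poly A)) (complex_of_real (Re z)) = 0"
    using z eigenvalue_root_char_poly[OF C] of_real_hom.char_poly_hom[OF A, where 'a = complex]
    by simp
  then have "eigenvalue A (Re z)"
    using eigenvalue_root_char_poly[OF A] by simp
  then show ?thesis by (rule that)
qed

definition normalized_vec :: "real vec \<Rightarrow> real vec" where
  "normalized_vec v = (1 / sqrt (v \<bullet> v)) \<cdot>\<^sub>v v"

lemma normalized_vec_carrier: "v \<in> carrier_vec n \<Longrightarrow> normalized_vec v \<in> carrier_vec n"
  by (simp add: normalized_vec_def)

lemma normalized_vec_scalar_prod:
  assumes "v \<in> carrier_vec n" "w \<in> carrier_vec n"
  shows "normalized_vec v \<bullet> normalized_vec w = (v \<bullet> w) / (sqrt (v \<bullet> v) * sqrt (w \<bullet> w))"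
  using assms by (simp add: normalized_vec_def)

lemma col_mat_of_cols_normalized_vec:
  assumes "set ws \<subseteq> carrier_vec n" "i < length ws"
  shows "col (mat_of_cols n (map normalized_vec ws)) i = normalized_vec (ws ! i)"
proof -
  have "ws ! i \<in> carrier_vec n"
    using assms by auto
  then show ?thesis
    using assms(2) by (simp add: normalized_vec_carrier)
qed

lemma mat_of_cols_normalized_vec_isometry:
  assumes ws: "set ws \<subseteq> carrier_vec n" and orth: "corthogonal ws"
  defines "W \<equiv> mat_of_cols n (map normalized_vec ws)"
  shows "W\<^sup>T * W = 1\<^sub>m (length ws)"
proof (rule eq_matI)
  fix i j
  assume "i < dim_row (1\<^sub>m (length ws) :: real mat)" "j < dim_col (1\<^sub>m (length ws) :: real mat)"
  then have ij: "i < length ws" "j < length ws"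
    by simp_all
  then have carrier: "ws ! i \<in> carrier_vec n" "ws ! j \<in> carrier_vec n"
    using ws by auto
  have "(W\<^sup>T * W) $$ (i, j) = normalized_vec (ws ! i) \<bullet> normalized_vec (ws ! j)"
    using ij by (simp add: W_def col_mat_of_cols_normalized_vec[OF ws])
  also have "\<dots> = (ws ! i \<bullet> ws ! j) / (sqrt (ws ! i \<bullet> ws ! i) * sqrt (ws ! j \<bullet> ws ! j))"
    using carrier by (rule normalized_vec_scalar_prod)
  also have "\<dots> = (if i = j then 1 else 0)"
    using corthogonalD[OF orth ij] conjugate_square_ge_0_vec[of "ws ! i"] by auto
  finally show "(W\<^sup>T * W) $$ (i, j) = 1\<^sub>m (length ws) $$ (i, j)"
    using ij by simp
qed (simp_all add: W_def)

lemma orthogonal_matrix_with_normalized_first_column: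
  fixes v :: "real vec"
  assumes v: "v \<in> carrier_vec n" "v \<noteq> 0\<^sub>v n"
  obtains W where "W \<in> carrier_mat n n" "W\<^sup>T * W = 1\<^sub>m n" "col W 0 = normalized_vec v"
proof -
  interpret cof_vec_space n "TYPE(real)" .
  note basis = basis_completion[OF v]
  define ws where "ws = gram_schmidt n (basis_completion v)"
  note ws = gram_schmidt_result[OF basis(2,4,5) ws_def]
  have n: "n > 0"
    using v by (cases n) auto
  have len: "length ws = n"
    using ws(4) basis(6) by simp
  have hd: "ws ! 0 = v"
    using basis(6,7) gram_schmidt_hd[OF v(1)] n len
    by (metis hd_conv_nth length_greater_0_conv list.collapse ws_def)
  define W where "W = mat_of_cols n (map normalized_vec ws)"
  have "W \<in> carrier_mat n n"
    using mat_of_cols_carrier(1)[of n "map normalized_vec ws"] by (simp add: W_def len)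
  moreover have "W\<^sup>T * W = 1\<^sub>m n"
    using mat_of_cols_normalized_vec_isometry[OF ws(3,2)] by (simp add: W_def len)
  moreover have "col W 0 = normalized_vec v"
    using col_mat_of_cols_normalized_vec[OF ws(3)] n by (simp add: W_def len hd)
  ultimately show ?thesis
    by (rule that)
qed

lemma symmetric_mat_first_block:
  fixes B :: "'a :: comm_semiring_1 mat"
  assumes B: "B \<in> carrier_mat (Suc n) (Suc n)" and sym: "B\<^sup>T = B"
    and col: "col B 0 = k \<cdot>\<^sub>v unit_vec (Suc n) 0"
  obtains C where "C \<in> carrier_mat n n" "C\<^sup>T = C"
    "B = four_block_mat (mat_diag 1 (\<lambda>_. k)) (0\<^sub>m 1 n) (0\<^sub>m n 1) C"
proof -
  have B_sym: "B $$ (i, j) = B $$ (j, i)" if "i < Suc n" "j < Suc n" for i j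
    using sym B that by (metis carrier_matD index_transpose_mat(1))
  have B_col: "B $$ (i, 0) = (if i = 0 then k else 0)" if "i < Suc n" for i
    using arg_cong[OF col, of "\<lambda>x. x $ i"] that B by auto
  have B_row: "B $$ (0, i) = (if i = 0 then k else 0)" if "i < Suc n" for i
    using B_col[OF that] B_sym[of 0 i] that by simp
  define C where "C = mat n n (\<lambda>(i, j). B $$ (Suc i, Suc j))"
  have "C \<in> carrier_mat n n"
    by (simp add: C_def)
  moreover have "C\<^sup>T = C"
    by (rule eq_matI) (auto simp: C_def B_sym)
  moreover have "B = four_block_mat (mat_diag 1 (\<lambda>_. k)) (0\<^sub>m 1 n) (0\<^sub>m n 1) C"
    by (rule eq_matI) (use B in \<open>auto simp: B_row B_col C_def mat_diag_def\<close>)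
  ultimately show ?thesis
    by (rule that)
qed

lemma mat_diag_Suc:
  "mat_diag (Suc n) (case_nat k d) =
    four_block_mat (mat_diag 1 (\<lambda>_. k)) (0\<^sub>m 1 n) (0\<^sub>m n 1) (mat_diag n d)"
  by (rule eq_matI) (auto simp: mat_diag_def split: nat.split)

lemma col_conjugation_of_eigenvector:
  fixes A W :: "'a :: field mat"
  assumes A: "A \<in> carrier_mat n n" and W: "W \<in> carrier_mat n n" "W\<^sup>T * W = 1\<^sub>m n"
    and j: "j < n" and eigen: "A *\<^sub>v col W j = k \<cdot>\<^sub>v col W j"
  shows "col (W\<^sup>T * A * W) j = k \<cdot>\<^sub>v unit_vec n j"
proof -
  have "col (W\<^sup>T * A * W) j = W\<^sup>T *\<^sub>v (A *\<^sub>v col W j)"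
    using A W(1) j by (subst col_mult2[of _ n n]) (auto intro!: assoc_mult_mat_vec)
  also have "\<dots> = k \<cdot>\<^sub>v (W\<^sup>T *\<^sub>v col W j)"
    unfolding eigen using W(1) j by (intro mult_mat_vec) auto
  also have "W\<^sup>T *\<^sub>v col W j = col (W\<^sup>T * W) j"
    using W(1) j by (intro col_mult2[symmetric]) auto
  finally show ?thesis
    using j by (simp add: W(2))
qed

lemma real_symmetric_deflation:
  fixes A :: "real mat"
  assumes A: "A \<in> carrier_mat (Suc n) (Suc n)" and sym: "A\<^sup>T = A"
  obtains k C where "C \<in> carrier_mat n n" "C\<^sup>T = C"
    "orthogonally_similar A (four_block_mat (mat_diag 1 (\<lambda>_. k)) (0\<^sub>m 1 n) (0\<^sub>m n 1) C)"
proof -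
  obtain k where "eigenvalue A k"
    using real_symmetric_has_eigenvalue[OF A sym] by blast
  then obtain v where v: "v \<in> carrier_vec (Suc n)" "v \<noteq> 0\<^sub>v (Suc n)" "A *\<^sub>v v = k \<cdot>\<^sub>v v"
    using A unfolding eigenvalue_def eigenvector_def by auto
  obtain W where W: "W \<in> carrier_mat (Suc n) (Suc n)" "W\<^sup>T * W = 1\<^sub>m (Suc n)"
    and W_col: "col W 0 = normalized_vec v"
    using orthogonal_matrix_with_normalized_first_column[OF v(1,2)] by blast
  define B where "B = W\<^sup>T * A * W"
  have B: "B \<in> carrier_mat (Suc n) (Suc n)"
    using A W(1) by (simp add: B_def)
  have B_sym: "B\<^sup>T = B"
    unfolding B_def transpose_congruence[OF A W(1)] sym ..
  have "A *\<^sub>v col W 0 = k \<cdot>\<^sub>v col W 0"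
    using A v
    by (simp add: W_col normalized_vec_def mult_mat_vec[OF A] smult_smult_assoc mult.commute)
  then have "col B 0 = k \<cdot>\<^sub>v unit_vec (Suc n) 0"
    unfolding B_def using A W by (intro col_conjugation_of_eigenvector) auto
  then obtain C where C: "C \<in> carrier_mat n n" "C\<^sup>T = C"
    and B_block: "B = four_block_mat (mat_diag 1 (\<lambda>_. k)) (0\<^sub>m 1 n) (0\<^sub>m n 1) C"
    using symmetric_mat_first_block[OF B B_sym] by blast
  have "orthogonally_similar A B"
    unfolding B_def using A W by (rule orthogonally_similar_conjugation)
  then show ?thesis
    using that C unfolding B_block by blast
qed

theorem real_symmetric_orthogonally_similar_mat_diag:
  fixes A :: "real mat"
  assumes "A \<in> carrier_mat n n" and "A\<^sup>T = A"
  shows "\<exists>d. orthogonally_similar A (mat_diag n d)"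
  using assms
proof (induction n arbitrary: A)
  case 0
  then have "A = mat_diag 0 (\<lambda>_. 0)"
    by (intro eq_matI) (auto simp: mat_diag_def)
  then show ?case
    using 0 orthogonally_similar_refl by metis
next
  case (Suc n)
  obtain k C where C: "C \<in> carrier_mat n n" "C\<^sup>T = C"
    and AC: "orthogonally_similar A (four_block_mat (mat_diag 1 (\<lambda>_. k)) (0\<^sub>m 1 n) (0\<^sub>m n 1) C)"
    using real_symmetric_deflation[OF Suc.prems] by blast
  obtain d where d: "orthogonally_similar C (mat_diag n d)"
    using Suc.IH C by blast
  have "orthogonally_similar (four_block_mat (mat_diag 1 (\<lambda>_. k)) (0\<^sub>m 1 n) (0\<^sub>m n 1) C)
      (mat_diag (Suc n) (case_nat k d))"
    unfolding mat_diag_Suc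
    by (rule orthogonally_similar_four_block[OF orthogonally_similar_refl d _ C(1)])
      (rule mat_diag_dim)+
  then show ?case
    using orthogonally_similar_trans[OF AC] by blast
qed

section \<open>Counting eigenvalues\<close>

definition eigenvalue_mset :: "'a :: idom mat \<Rightarrow> 'a multiset" where
  "eigenvalue_mset A = proots (char_poly A)"

lemma eigenvalue_mset_similar: "similar_mat A B \<Longrightarrow> eigenvalue_mset A = eigenvalue_mset B"
  by (simp add: eigenvalue_mset_def char_poly_similar)

lemma eigenvalue_mset_mat_diag:
  fixes d :: "nat \<Rightarrow> 'a :: idom"
  shows "eigenvalue_mset (mat_diag n d) = mset (map d [0..<n])"
proof -
  have "char_poly (mat_diag n d) = (\<Prod>a\<leftarrow>diag_mat (mat_diag n d). [:- a, 1:])"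
    by (rule char_poly_upper_triangular[where n = n]) (auto simp: mat_diag_def upper_triangular_def)
  also have "diag_mat (mat_diag n d) = map d [0..<n]"
    by (auto simp: diag_mat_def mat_diag_def)
  finally have char_poly: "char_poly (mat_diag n d) = (\<Prod>a\<leftarrow>map d [0..<n]. [:- a, 1:])" .
  have "proots (\<Prod>a\<leftarrow>as. [:- a, 1:]) = mset as" for as :: "'a list"
  proof (induction as)
    case (Cons a as)
    moreover have "(\<Prod>a\<leftarrow>as. [:- a, 1:]) \<noteq> 0"
      by (auto simp: prod_list_zero_iff)
    ultimately show ?case
      by (simp add: proots_mult del: mult_pCons_left)
  qed simp
  then show ?thesis
    by (simp only: eigenvalue_mset_def char_poly)
qed

lemma size_filter_eigenvalue_mset_mat_diag:
  fixes d :: "nat \<Rightarrow> 'a :: idom"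
  shows "size (filter_mset R (eigenvalue_mset (mat_diag n d))) =
    length (filter (\<lambda>l. R (d l)) [0..<n])"
proof -
  have "size (filter_mset R (eigenvalue_mset (mat_diag n d))) = length (filter R (map d [0..<n]))"
    unfolding eigenvalue_mset_mat_diag by (metis mset_filter size_mset)
  then show ?thesis
    by (simp add: filter_map o_def)
qed

lemma isometry_scalar_prod:
  fixes N :: "'a :: comm_semiring_1 mat"
  assumes N: "N \<in> carrier_mat n k" "N\<^sup>T * N = 1\<^sub>m k"
    and x: "x \<in> carrier_vec k" and y: "y \<in> carrier_vec k"
  shows "(N *\<^sub>v x) \<bullet> (N *\<^sub>v y) = x \<bullet> y"
proof -
  have "(N *\<^sub>v x) \<bullet> (N *\<^sub>v y) = (N\<^sup>T *\<^sub>v (N *\<^sub>v x)) \<bullet> y"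
    using N(1) x y by (intro transpose_vec_mult_scalar[symmetric]) auto
  also have "N\<^sup>T *\<^sub>v (N *\<^sub>v x) = (N\<^sup>T * N) *\<^sub>v x"
    using N(1) x by (intro assoc_mult_mat_vec[symmetric]) auto
  finally show ?thesis using x by (simp add: N(2))
qed

lemma congruence_quadratic_form:
  fixes M :: "'a :: comm_semiring_1 mat"
  assumes N: "N \<in> carrier_mat n k" and M: "M \<in> carrier_mat n n" and z: "z \<in> carrier_vec k"
  shows "z \<bullet> (N\<^sup>T * M * N *\<^sub>v z) = (N *\<^sub>v z) \<bullet> (M *\<^sub>v (N *\<^sub>v z))"
proof -
  have assoc: "N\<^sup>T * M * N *\<^sub>v z = N\<^sup>T *\<^sub>v (M *\<^sub>v (N *\<^sub>v z))"
    using N M z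
    by (simp add: assoc_mult_mat_vec[of "N\<^sup>T" k n "M * N" k] assoc_mult_mat_vec[of M n n N k])
  have "z \<bullet> (N\<^sup>T * M * N *\<^sub>v z) = (N\<^sup>T *\<^sub>v (M *\<^sub>v (N *\<^sub>v z))) \<bullet> z"
    unfolding assoc using N M z by (intro comm_scalar_prod[of _ k]) auto
  also have "\<dots> = (M *\<^sub>v (N *\<^sub>v z)) \<bullet> (N *\<^sub>v z)"
    using N M z by (intro transpose_vec_mult_scalar[of _ n k]) auto
  also have "\<dots> = (N *\<^sub>v z) \<bullet> (M *\<^sub>v (N *\<^sub>v z))"
    using N M z by (intro comm_scalar_prod[of _ n]) auto
  finally show ?thesis .
qed

lemma wide_mat_nonzero_kernel:
  fixes A :: "'a :: field mat"
  assumes A: "A \<in> carrier_mat m k" and wide: "m < k"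
  obtains z where "z \<in> carrier_vec k" "z \<noteq> 0\<^sub>v k" "A *\<^sub>v z = 0\<^sub>v m"
proof -
  define r where "r = (\<lambda>i. if i < m then row A i else 0\<^sub>v k)"
  define M where "M = mat\<^sub>r k k (\<lambda>i. if i = m then 0\<^sub>v k else r i)"
  have M: "M \<in> carrier_mat k k"
    by (simp add: M_def)
  have "det M = 0"
    unfolding M_def by (rule det_row_0[OF wide]) (use A in \<open>auto simp: r_def\<close>)
  then obtain z where z: "z \<in> carrier_vec k" "z \<noteq> 0\<^sub>v k" "M *\<^sub>v z = 0\<^sub>v k"
    using det_0_iff_vec_prod_zero[OF M] by blast
  have "A *\<^sub>v z = 0\<^sub>v m"
  proof (rule eq_vecI)
    fix i assume "i < dim_vec (0\<^sub>v m :: 'a vec)"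
    then have i: "i < m" by simp
    have "row M i = row A i"
      using A i wide by (auto simp: M_def r_def)
    then show "(A *\<^sub>v z) $ i = 0\<^sub>v m $ i"
      using arg_cong[OF z(3), of "\<lambda>x. x $ i"] A M i wide by simp
  qed (use A in simp)
  then show ?thesis using z that by blast
qed

lemma mat_diag_index:
  "i < n \<Longrightarrow> j < n \<Longrightarrow> mat_diag n d $$ (i, j) = (if i = j then d j else 0)"
  by (simp add: mat_diag_def)

lemma mat_diag_quadratic_form:
  fixes y :: "'a :: comm_semiring_1 vec"
  assumes "y \<in> carrier_vec n"
  shows "y \<bullet> (mat_diag n d *\<^sub>v y) = (\<Sum>l<n. d l * (y $ l)\<^sup>2)"
proof -
  have "(mat_diag n d *\<^sub>v y) $ l = d l * y $ l" if "l < n" for l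
  proof -
    have "row (mat_diag n d) l = d l \<cdot>\<^sub>v unit_vec n l"
      using that by (intro eq_vecI) (auto simp: mat_diag_def)
    then show ?thesis
      using that assms by (simp add: mat_diag_def)
  qed
  then show ?thesis
    by (simp add: scalar_prod_def mat_diag_def atLeast0LessThan power2_eq_square mult_ac)
qed

lemma scalar_prod_self_eq_sum: "(y :: 'a :: comm_semiring_1 vec) \<bullet> y = (\<Sum>l<dim_vec y. (y $ l)\<^sup>2)"
  by (simp add: scalar_prod_def atLeast0LessThan power2_eq_square)

lemma mat_diag_quadratic_form_less:
  fixes y :: "real vec"
  assumes y: "y \<in> carrier_vec n" "y \<noteq> 0\<^sub>v n"
    and zero: "\<And>l. l < n \<Longrightarrow> w \<le> d l \<Longrightarrow> y $ l = 0"
  shows "y \<bullet> (mat_diag n d *\<^sub>v y) < w * (y \<bullet> y)"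
proof -
  obtain m where m: "m < n" "y $ m \<noteq> 0"
    using y by (metis carrier_vecD eq_vecI index_zero_vec)
  have "d l * (y $ l)\<^sup>2 \<le> w * (y $ l)\<^sup>2" if "l < n" for l
    using zero[OF that] by (cases "w \<le> d l") (auto intro: mult_right_mono)
  moreover have "d m * (y $ m)\<^sup>2 < w * (y $ m)\<^sup>2"
    using zero[of m] m by (intro mult_strict_right_mono) force+
  ultimately have "(\<Sum>l<n. d l * (y $ l)\<^sup>2) < (\<Sum>l<n. w * (y $ l)\<^sup>2)"
    using m(1) by (intro sum_strict_mono_ex1) auto
  then show ?thesis
    using y(1) by (simp add: mat_diag_quadratic_form scalar_prod_self_eq_sum sum_distrib_left)
qed

text \<open>
  If there were fewer than \<open>k\<close> indices \<open>l\<close> with \<open>w \<le> d l\<close>, some nonzero vector in the range of \<open>N\<close>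
  would vanish at all of them, and its Rayleigh quotient would be less than \<open>w\<close>.
\<close>

lemma mat_diag_quadratic_form_ge_imp_count:
  fixes d :: "nat \<Rightarrow> real"
  assumes N: "N \<in> carrier_mat n k"
    and inj: "\<And>z. z \<in> carrier_vec k \<Longrightarrow> z \<noteq> 0\<^sub>v k \<Longrightarrow> N *\<^sub>v z \<noteq> 0\<^sub>v n"
    and form: "\<And>z. z \<in> carrier_vec k \<Longrightarrow>
      w * ((N *\<^sub>v z) \<bullet> (N *\<^sub>v z)) \<le> (N *\<^sub>v z) \<bullet> (mat_diag n d *\<^sub>v (N *\<^sub>v z))"
  shows "k \<le> length (filter (\<lambda>l. w \<le> d l) [0..<n])"
proof (rule ccontr)
  define ls where "ls = filter (\<lambda>l. w \<le> d l) [0..<n]"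
  define R where "R = mat_of_rows k (map (row N) ls)"
  assume "\<not> k \<le> length (filter (\<lambda>l. w \<le> d l) [0..<n])"
  then have "length ls < k"
    by (simp add: ls_def)
  moreover have R: "R \<in> carrier_mat (length ls) k"
    using mat_of_rows_carrier(1)[of k "map (row N) ls"] by (simp add: R_def)
  ultimately obtain z where z: "z \<in> carrier_vec k" "z \<noteq> 0\<^sub>v k" "R *\<^sub>v z = 0\<^sub>v (length ls)"
    by (metis wide_mat_nonzero_kernel)
  have zero: "(N *\<^sub>v z) $ l = 0" if l: "l < n" "w \<le> d l" for l
  proof -
    have "l \<in> set ls"
      using l by (simp add: ls_def)
    then obtain i where i: "i < length ls" "ls ! i = l"
      by (metis in_set_conv_nth)
    have "row R i = row N l"
      using i l N by (simp add: R_def)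
    then show ?thesis
      using arg_cong[OF z(3), of "\<lambda>x. x $ i"] i(1) l(1) N R by simp
  qed
  have "(N *\<^sub>v z) \<bullet> (mat_diag n d *\<^sub>v (N *\<^sub>v z)) < w * ((N *\<^sub>v z) \<bullet> (N *\<^sub>v z))"
    using N z inj by (intro mat_diag_quadratic_form_less[where n = n] zero) auto
  then show False
    using form[OF z(1)] by simp
qed

theorem quadratic_form_ge_imp_eigenvalue_count:
  fixes M N :: "real mat"
  assumes M: "M \<in> carrier_mat n n" "M\<^sup>T = M" and N: "N \<in> carrier_mat n k"
    and inj: "\<And>z. z \<in> carrier_vec k \<Longrightarrow> z \<noteq> 0\<^sub>v k \<Longrightarrow> N *\<^sub>v z \<noteq> 0\<^sub>v n"
    and form: "\<And>z. z \<in> carrier_vec k \<Longrightarrow>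
      w * ((N *\<^sub>v z) \<bullet> (N *\<^sub>v z)) \<le> (N *\<^sub>v z) \<bullet> (M *\<^sub>v (N *\<^sub>v z))"
  shows "k \<le> size {#x \<in># eigenvalue_mset M. w \<le> x#}"
proof -
  obtain d where d: "orthogonally_similar M (mat_diag n d)"
    using real_symmetric_orthogonally_similar_mat_diag[OF M] by blast
  then obtain P where "similar_mat_wit M (mat_diag n d) P P\<^sup>T"
    unfolding orthogonally_similar_def by blast
  note P = similar_mat_witD2[OF M(1) this]
  define Q where "Q = P\<^sup>T * N"
  have PT: "P\<^sup>T \<in> carrier_mat n n" "(P\<^sup>T)\<^sup>T * P\<^sup>T = 1\<^sub>m n"
    using P by auto
  have Nz: "N *\<^sub>v z \<in> carrier_vec n" and Qz: "Q *\<^sub>v z = P\<^sup>T *\<^sub>v (N *\<^sub>v z)"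
    if "z \<in> carrier_vec k" for z
    using N that assoc_mult_mat_vec[OF PT(1) N that] by (simp_all add: Q_def)
  have norm: "(Q *\<^sub>v z) \<bullet> (Q *\<^sub>v z) = (N *\<^sub>v z) \<bullet> (N *\<^sub>v z)" if "z \<in> carrier_vec k" for z
    unfolding Qz[OF that] by (rule isometry_scalar_prod[OF PT Nz[OF that] Nz[OF that]])
  have "k \<le> length (filter (\<lambda>l. w \<le> d l) [0..<n])"
  proof (rule mat_diag_quadratic_form_ge_imp_count)
    fix z :: "real vec" assume z: "z \<in> carrier_vec k"
    show "Q *\<^sub>v z \<noteq> 0\<^sub>v n" if "z \<noteq> 0\<^sub>v k"
      using norm[OF z] inj[OF z that] conjugate_square_eq_0_vec[OF Nz[OF z]] by auto
    have "(N *\<^sub>v z) \<bullet> (M *\<^sub>v (N *\<^sub>v z)) = (Q *\<^sub>v z) \<bullet> (mat_diag n d *\<^sub>v (Q *\<^sub>v z))"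
      using congruence_quadratic_form[OF PT(1) mat_diag_dim Nz[OF z], of d] P(3)
      by (simp add: Qz[OF z])
    then show "w * ((Q *\<^sub>v z) \<bullet> (Q *\<^sub>v z)) \<le> (Q *\<^sub>v z) \<bullet> (mat_diag n d *\<^sub>v (Q *\<^sub>v z))"
      using form[OF z] norm[OF z] by simp
  qed (use PT N in \<open>simp add: Q_def\<close>)
  also have "\<dots> = size {#x \<in># eigenvalue_mset (mat_diag n d). w \<le> x#}"
    by (rule size_filter_eigenvalue_mset_mat_diag[symmetric])
  also have "eigenvalue_mset (mat_diag n d) = eigenvalue_mset M"
    using d orthogonally_similar_imp_similar_mat eigenvalue_mset_similar by metis
  finally show ?thesis .
qed

definition coordinate_embedding :: "nat \<Rightarrow> nat \<Rightarrow> (nat \<Rightarrow> nat) \<Rightarrow> 'a :: zero_neq_one mat" where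
  "coordinate_embedding n k s = mat n k (\<lambda>(i, a). if i = s a then 1 else 0)"

lemma coordinate_embedding_carrier: "coordinate_embedding n k s \<in> carrier_mat n k"
  by (simp add: coordinate_embedding_def)

lemma col_coordinate_embedding:
  "a < k \<Longrightarrow> s a < n \<Longrightarrow> col (coordinate_embedding n k s) a = unit_vec n (s a)"
  by (auto simp: coordinate_embedding_def unit_vec_def)

lemma coordinate_embedding_isometry:
  assumes "inj_on s {..<k}" "s ` {..<k} \<subseteq> {..<n}"
  shows "(coordinate_embedding n k s)\<^sup>T * coordinate_embedding n k s =
    (1\<^sub>m k :: 'a :: semiring_1 mat)"
proof -
  have "s a < n" "s a = s b \<longleftrightarrow> a = b" if "a < k" "b < k" for a b
    using assms that by (auto simp: inj_on_eq_iff)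
  then show ?thesis
    by (intro eq_matI)
      (auto simp: col_coordinate_embedding carrier_matD[OF coordinate_embedding_carrier])
qed

lemma coordinate_embedding_diagonal_compression:
  fixes M :: "'a :: semiring_1 mat"
  assumes M: "M \<in> carrier_mat n n" and s: "s ` {..<k} \<subseteq> {..<n}"
    and off_diag: "\<And>a b. a < k \<Longrightarrow> b < k \<Longrightarrow> a \<noteq> b \<Longrightarrow> M $$ (s a, s b) = 0"
  shows "(coordinate_embedding n k s)\<^sup>T * M * coordinate_embedding n k s =
    mat_diag k (\<lambda>a. M $$ (s a, s a))"
    (is "?N\<^sup>T * M * ?N = ?D")
proof (rule eq_matI)
  fix a b assume "a < dim_row ?D" "b < dim_col ?D"
  then have ab: "a < k" "b < k"
    by (simp_all add: mat_diag_def)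
  then have "s a < n" "s b < n"
    using s by auto
  then have "(?N\<^sup>T * M * ?N) $$ (a, b) = M $$ (s a, s b)"
    using M ab by (simp add: col_coordinate_embedding carrier_matD[OF coordinate_embedding_carrier])
  then show "(?N\<^sup>T * M * ?N) $$ (a, b) = ?D $$ (a, b)"
    using off_diag ab by (auto simp: mat_diag_index)
qed (simp_all add: mat_diag_def carrier_matD[OF coordinate_embedding_carrier])

lemma card_le_eigenvalues_ge_of_diagonal_principal_submatrix:
  fixes M :: "real mat"
  assumes M: "M \<in> carrier_mat n n" "M\<^sup>T = M" and S: "S \<subseteq> {..<n}"
    and off_diag: "\<And>i j. i \<in> S \<Longrightarrow> j \<in> S \<Longrightarrow> i \<noteq> j \<Longrightarrow> M $$ (i, j) = 0"
    and diag: "\<And>i. i \<in> S \<Longrightarrow> w \<le> M $$ (i, i)"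
  shows "card S \<le> size {#x \<in># eigenvalue_mset M. w \<le> x#}"
proof -
  have "finite S"
    using S finite_subset by blast
  then obtain s where "bij_betw s {0..<card S} S"
    using ex_bij_betw_nat_finite by blast
  then have s: "inj_on s {..<card S}" "s ` {..<card S} = S"
    by (auto simp: bij_betw_def atLeast0LessThan)
  define N :: "real mat" where "N = coordinate_embedding n (card S) s"
  have N: "N \<in> carrier_mat n (card S)" "N\<^sup>T * N = 1\<^sub>m (card S)"
    using s S by (simp_all add: N_def coordinate_embedding_carrier coordinate_embedding_isometry)
  note norm = isometry_scalar_prod[OF N]
  have "M $$ (s a, s b) = 0" if "a < card S" "b < card S" "a \<noteq> b" for a b
    using s that by (intro off_diag) (auto simp: inj_on_eq_iff)
  then have "N\<^sup>T * M * N = mat_diag (card S) (\<lambda>a. M $$ (s a, s a))"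
    unfolding N_def using M(1) s(2) S by (intro coordinate_embedding_diagonal_compression) auto
  then have form: "(N *\<^sub>v z) \<bullet> (M *\<^sub>v (N *\<^sub>v z)) = (\<Sum>a<card S. M $$ (s a, s a) * (z $ a)\<^sup>2)"
    if "z \<in> carrier_vec (card S)" for z
    using congruence_quadratic_form[OF N(1) M(1) that] mat_diag_quadratic_form[OF that] by simp
  show ?thesis
  proof (rule quadratic_form_ge_imp_eigenvalue_count[OF M N(1)])
    fix z :: "real vec" assume z: "z \<in> carrier_vec (card S)"
    show "N *\<^sub>v z \<noteq> 0\<^sub>v n" if "z \<noteq> 0\<^sub>v (card S)"
      using norm[OF z z] conjugate_square_eq_0_vec[OF z] that by auto
    have "w * (z \<bullet> z) = (\<Sum>a<card S. w * (z $ a)\<^sup>2)"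
      using z by (simp add: scalar_prod_self_eq_sum sum_distrib_left)
    also have "\<dots> \<le> (\<Sum>a<card S. M $$ (s a, s a) * (z $ a)\<^sup>2)"
      using diag s(2) by (intro sum_mono mult_right_mono) auto
    finally show "w * ((N *\<^sub>v z) \<bullet> (N *\<^sub>v z)) \<le> (N *\<^sub>v z) \<bullet> (M *\<^sub>v (N *\<^sub>v z))"
      by (simp only: norm[OF z z] form[OF z])
  qed
qed

section \<open>Polynomials of symmetric matrices\<close>

lemma poly_mat_carrier: "A \<in> carrier_mat n n \<Longrightarrow> poly_mat p A \<in> carrier_mat n n"
  by (simp add: poly_mat_def)

lemma poly_mat_index:
  assumes "A \<in> carrier_mat n n" "i < n" "j < n"
  shows "poly_mat p A $$ (i, j) = (\<Sum>k\<le>degree p. coeff p k * (A ^\<^sub>m k) $$ (i, j))"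
  using assms by (simp add: poly_mat_def)

lemma poly_mat_uminus: "poly_mat (- p) A = - poly_mat p A"
  by (rule eq_matI) (auto simp: poly_mat_def sum_negf)

lemma triple_mult_mat_index:
  assumes "P \<in> carrier_mat nr n" "M \<in> carrier_mat n m" "Q \<in> carrier_mat m nc" "i < nr" "j < nc"
  shows "(P * M * Q) $$ (i, j) = (\<Sum>l<m. \<Sum>k<n. P $$ (i, k) * M $$ (k, l) * Q $$ (l, j))"
  using assms by (simp add: scalar_prod_def atLeast0LessThan sum_distrib_right del: assoc_mult_mat)

lemma similar_mat_wit_poly_mat:
  assumes "similar_mat_wit A B P Q"
  shows "similar_mat_wit (poly_mat p A) (poly_mat p B) P Q"
proof -
  define n where "n = dim_row A"
  note wit = similar_mat_witD[OF n_def assms]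
  have "poly_mat p A = P * poly_mat p B * Q"
  proof (rule eq_matI)
    fix i j assume "i < dim_row (P * poly_mat p B * Q)" "j < dim_col (P * poly_mat p B * Q)"
    then have ij: "i < n" "j < n"
      using wit(6,7) by auto
    let ?f = "\<lambda>k l m. coeff p k * (P $$ (i, m) * (B ^\<^sub>m k) $$ (m, l) * Q $$ (l, j))"
    have "(A ^\<^sub>m k) $$ (i, j) = (\<Sum>l<n. \<Sum>m<n. P $$ (i, m) * (B ^\<^sub>m k) $$ (m, l) * Q $$ (l, j))"
      for k
      unfolding similar_mat_wit_pow_id[OF assms]
      using wit(6) pow_carrier_mat[OF wit(5)] wit(7) ij by (rule triple_mult_mat_index)
    then have "poly_mat p A $$ (i, j) = (\<Sum>k\<le>degree p. \<Sum>l<n. \<Sum>m<n. ?f k l m)"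
      by (simp add: poly_mat_index[OF wit(4) ij] sum_distrib_left)
    also have "\<dots> = (\<Sum>l<n. \<Sum>k\<le>degree p. \<Sum>m<n. ?f k l m)"
      by (rule sum.swap)
    also have "\<dots> = (\<Sum>l<n. \<Sum>m<n. \<Sum>k\<le>degree p. ?f k l m)"
      by (intro sum.cong refl sum.swap)
    also have "\<dots> = (P * poly_mat p B * Q) $$ (i, j)"
      unfolding triple_mult_mat_index[OF wit(6) poly_mat_carrier[OF wit(5)] wit(7) ij]
      by (intro sum.cong refl)
        (simp add: poly_mat_index[OF wit(5)] sum_distrib_left sum_distrib_right mult_ac)
    finally show "poly_mat p A $$ (i, j) = (P * poly_mat p B * Q) $$ (i, j)" .
  qed (use wit(4,6,7) poly_mat_carrier in auto)
  then show ?thesis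
    using wit by (intro similar_mat_witI poly_mat_carrier)
qed

lemma mat_diag_pow: "mat_diag n d ^\<^sub>m k = mat_diag n (\<lambda>i. d i ^ k)"
  by (induction k) (simp_all add: power_commutes carrier_matD(1)[OF mat_diag_dim])

lemma poly_mat_mat_diag: "poly_mat p (mat_diag n d) = mat_diag n (\<lambda>i. poly p (d i))"
  by (rule eq_matI)
    (auto simp: poly_mat_index[OF mat_diag_dim] mat_diag_pow mat_diag_index poly_altdef poly_mat_def
      carrier_matD[OF mat_diag_dim])

lemma orthogonally_similar_poly_mat_mat_diag:
  assumes "orthogonally_similar A (mat_diag n d)"
  shows "orthogonally_similar (poly_mat p A) (mat_diag n (\<lambda>i. poly p (d i)))"
proof -
  obtain P where "similar_mat_wit A (mat_diag n d) P P\<^sup>T"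
    using assms unfolding orthogonally_similar_def by blast
  then have "similar_mat_wit (poly_mat p A) (poly_mat p (mat_diag n d)) P P\<^sup>T"
    by (rule similar_mat_wit_poly_mat)
  then show ?thesis
    unfolding orthogonally_similar_def poly_mat_mat_diag by blast
qed

lemma poly_mat_symmetric:
  assumes "A \<in> carrier_mat n n" "A\<^sup>T = A"
  shows "(poly_mat p A)\<^sup>T = poly_mat p A"
proof -
  obtain d where "orthogonally_similar A (mat_diag n d)"
    using real_symmetric_orthogonally_similar_mat_diag[OF assms] by blast
  then have "orthogonally_similar (poly_mat p A) (mat_diag n (\<lambda>i. poly p (d i)))"
    by (rule orthogonally_similar_poly_mat_mat_diag)
  then show ?thesis
    by (rule orthogonally_similar_mat_diag_imp_symmetric)
qed

lemma eigenvalue_mset_orthogonally_similar_mat_diag: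
  "orthogonally_similar A (mat_diag n d) \<Longrightarrow> eigenvalue_mset A = mset (map d [0..<n])"
  unfolding eigenvalue_mset_mat_diag[symmetric]
  by (intro eigenvalue_mset_similar orthogonally_similar_imp_similar_mat)

lemma eigenvalue_mset_poly_mat:
  assumes "A \<in> carrier_mat n n" "A\<^sup>T = A"
  shows "eigenvalue_mset (poly_mat p A) = image_mset (poly p) (eigenvalue_mset A)"
proof -
  obtain d where d: "orthogonally_similar A (mat_diag n d)"
    using real_symmetric_orthogonally_similar_mat_diag[OF assms] by blast
  show ?thesis
    unfolding eigenvalue_mset_orthogonally_similar_mat_diag[OF d]
      eigenvalue_mset_orthogonally_similar_mat_diag[OF orthogonally_similar_poly_mat_mat_diag[OF d]]
    by (simp add: multiset.map_comp o_def)
qed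

lemma size_eigenvalue_mset:
  fixes A :: "real mat"
  assumes "A \<in> carrier_mat n n" "A\<^sup>T = A"
  shows "size (eigenvalue_mset A) = n"
  using real_symmetric_orthogonally_similar_mat_diag[OF assms]
    eigenvalue_mset_orthogonally_similar_mat_diag by fastforce

lemma mset_eigenvalue_list: "mset (eigenvalue_list A) = eigenvalue_mset A"
  by (simp add: eigenvalue_list_def eigenvalue_mset_def)

lemma card_filter_eigenvalue_list:
  assumes "A \<in> carrier_mat n n" "A\<^sup>T = A"
  shows "card {i \<in> {1..n}. R (eigenvalue_list A ! (i - 1))} =
    size (filter_mset R (eigenvalue_mset A))"
    (is "card ?I = _")
proof -
  have len: "length (eigenvalue_list A) = n"
    using size_eigenvalue_mset[OF assms] by (metis mset_eigenvalue_list size_mset)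
  have "?I = Suc ` {i. i < n \<and> R (eigenvalue_list A ! i)}"
    by (auto simp: image_iff gr0_conv_Suc Suc_le_eq)
  then have "card ?I = length (filter R (eigenvalue_list A))"
    by (simp add: card_image length_filter_conv_card len)
  also have "\<dots> = size (filter_mset R (eigenvalue_mset A))"
    by (metis mset_eigenvalue_list mset_filter size_mset)
  finally show ?thesis .
qed

lemma card_le_poly_eigenvalues_ge_of_diagonal_principal_submatrix:
  assumes A: "A \<in> carrier_mat n n" "A\<^sup>T = A" and S: "S \<subseteq> {..<n}"
    and off_diag: "\<And>i j. i \<in> S \<Longrightarrow> j \<in> S \<Longrightarrow> i \<noteq> j \<Longrightarrow> poly_mat p A $$ (i, j) = 0"
    and diag: "\<And>i. i \<in> S \<Longrightarrow> w \<le> poly_mat p A $$ (i, i)"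
  shows "card S \<le> card {i \<in> {1..n}. w \<le> poly p (eigenvalue_list A ! (i - 1))}"
proof -
  have "card S \<le> size {#x \<in># eigenvalue_mset (poly_mat p A). w \<le> x#}"
    by (rule card_le_eigenvalues_ge_of_diagonal_principal_submatrix
        [OF poly_mat_carrier[OF A(1)] poly_mat_symmetric[OF A] S off_diag diag])
  also have "\<dots> = size {#x \<in># eigenvalue_mset A. w \<le> poly p x#}"
    by (simp add: eigenvalue_mset_poly_mat[OF A] filter_mset_image_mset)
  also have "\<dots> = card {i \<in> {1..n}. w \<le> poly p (eigenvalue_list A ! (i - 1))}"
    by (rule card_filter_eigenvalue_list[OF A, symmetric])
  finally show ?thesis .
qed

lemma card_le_poly_eigenvalues_le_of_diagonal_principal_submatrix:
  assumes A: "A \<in> carrier_mat n n" "A\<^sup>T = A" and S: "S \<subseteq> {..<n}"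
    and off_diag: "\<And>i j. i \<in> S \<Longrightarrow> j \<in> S \<Longrightarrow> i \<noteq> j \<Longrightarrow> poly_mat p A $$ (i, j) = 0"
    and diag: "\<And>i. i \<in> S \<Longrightarrow> poly_mat p A $$ (i, i) \<le> w"
  shows "card S \<le> card {i \<in> {1..n}. poly p (eigenvalue_list A ! (i - 1)) \<le> w}"
proof -
  have uminus_index: "poly_mat (- p) A $$ (i, j) = - poly_mat p A $$ (i, j)"
    if "i \<in> S" "j \<in> S" for i j
  proof -
    have "i < n" "j < n"
      using that S by auto
    then show ?thesis
      using poly_mat_carrier[OF A(1), of p] by (simp add: poly_mat_uminus)
  qed
  have "card S \<le> card {i \<in> {1..n}. - w \<le> poly (- p) (eigenvalue_list A ! (i - 1))}"
    by (rule card_le_poly_eigenvalues_ge_of_diagonal_principal_submatrix[OF A S])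
      (simp_all add: uminus_index off_diag diag)
  then show ?thesis by simp
qed

section \<open>Distances and adjacency matrices\<close>

lemma is_path_iff_successively:
  "is_path V E u xs v \<longleftrightarrow>
    xs \<noteq> [] \<and> hd xs = u \<and> last xs = v \<and> set xs \<subseteq> V \<and> distinct xs \<and>
    successively (\<lambda>x y. {x, y} \<in> E) xs"
  by (auto simp: is_path_def successively_conv_nth)

lemma is_path_extend:
  assumes path: "is_path V E u xs v" and edge: "{v, w} \<in> E" and w: "w \<in> V"
  obtains ys where "is_path V E u ys w" "length ys \<le> Suc (length xs)"
proof (cases "w \<in> set xs")
  case True
  then obtain as bs where xs: "xs = (as @ [w]) @ bs"
    by (metis append.assoc append_Cons append_Nil split_list)
  have "successively (\<lambda>x y. {x, y} \<in> E) ((as @ [w]) @ bs)"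
    using path xs by (simp only: is_path_iff_successively)
  then have "successively (\<lambda>x y. {x, y} \<in> E) (as @ [w])"
    by (simp only: successively_append_iff)
  then have "is_path V E u (as @ [w]) w"
    using path by (auto simp: is_path_iff_successively xs hd_append)
  then show ?thesis using that by (simp add: xs)
next
  case False
  then have "is_path V E u (xs @ [w]) w"
    using path edge w by (auto simp: is_path_iff_successively successively_append_iff)
  then show ?thesis using that by simp
qed

lemma graph_dist_le_iff:
  "graph_dist V E u v \<le> enat k \<longleftrightarrow> (\<exists>xs. is_path V E u xs v \<and> length xs \<le> Suc k)"
proof
  assume dist: "graph_dist V E u v \<le> enat k"
  show "\<exists>xs. is_path V E u xs v \<and> length xs \<le> Suc k"
  proof (rule ccontr)
    assume "\<nexists>xs. is_path V E u xs v \<and> length xs \<le> Suc k"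
    then have "enat (Suc k) \<le> graph_dist V E u v"
      unfolding graph_dist_def by (intro INF_greatest) force
    then show False
      using dist by (metis enat_ord_simps(1) not_less_eq_eq order_refl order_trans)
  qed
next
  assume "\<exists>xs. is_path V E u xs v \<and> length xs \<le> Suc k"
  then obtain xs where xs: "is_path V E u xs v" "length xs \<le> Suc k"
    by blast
  have "graph_dist V E u v \<le> enat (length xs - 1)"
    unfolding graph_dist_def using xs(1) by (intro INF_lower) simp
  also have "\<dots> \<le> enat k"
    using xs(2) by simp
  finally show "graph_dist V E u v \<le> enat k" .
qed

lemma graph_dist_le_Suc:
  assumes "graph_dist V E u v \<le> enat k" "{v, w} \<in> E" "w \<in> V"
  shows "graph_dist V E u w \<le> enat (Suc k)"
proof -
  obtain xs where xs: "is_path V E u xs v" "length xs \<le> Suc k"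
    using assms(1) unfolding graph_dist_le_iff by blast
  obtain ys where "is_path V E u ys w" "length ys \<le> Suc (length xs)"
    using is_path_extend[OF xs(1) assms(2,3)] by blast
  then show ?thesis
    unfolding graph_dist_le_iff using xs(2) by fastforce
qed

lemma adjacency_matrix_carrier: "adjacency_matrix vs E \<in> carrier_mat (length vs) (length vs)"
  by (simp add: adjacency_matrix_def)

lemma adjacency_matrix_symmetric: "(adjacency_matrix vs E)\<^sup>T = adjacency_matrix vs E"
  by (rule eq_matI) (auto simp: adjacency_matrix_def insert_commute)

lemma graph_dist_le_of_adjacency_matrix_pow_nonzero:
  assumes "i < length vs" "j < length vs" "(adjacency_matrix vs E ^\<^sub>m k) $$ (i, j) \<noteq> 0"
  shows "graph_dist (set vs) E (vs ! i) (vs ! j) \<le> enat k"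
  using assms
proof (induction k arbitrary: j)
  case 0
  then have "i = j"
    by (auto simp: adjacency_matrix_def split: if_splits)
  then have "is_path (set vs) E (vs ! i) [vs ! i] (vs ! j)"
    using 0 by (simp add: is_path_def)
  then show ?case
    unfolding graph_dist_le_iff by force
next
  case (Suc k)
  let ?A = "adjacency_matrix vs E" and ?n = "length vs"
  note A = adjacency_matrix_carrier[of vs E]
  have "(?A ^\<^sub>m Suc k) $$ (i, j) = (\<Sum>l<?n. (?A ^\<^sub>m k) $$ (i, l) * ?A $$ (l, j))"
    using Suc.prems A by (simp add: scalar_prod_def atLeast0LessThan)
  then obtain l where l: "l < ?n" "(?A ^\<^sub>m k) $$ (i, l) \<noteq> 0" "?A $$ (l, j) \<noteq> 0"
    using Suc.prems(3) by (metis (no_types, lifting) lessThan_iff mult_eq_0_iff sum.neutral)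
  have "graph_dist (set vs) E (vs ! i) (vs ! l) \<le> enat k"
    using Suc.IH Suc.prems(1) l(1,2) by blast
  moreover have "{vs ! l, vs ! j} \<in> E"
    using l Suc.prems by (auto simp: adjacency_matrix_def split: if_splits)
  ultimately show ?case
    using Suc.prems(2) by (intro graph_dist_le_Suc) auto
qed

lemma poly_mat_adjacency_matrix_eq_0:
  assumes ij: "i < length vs" "j < length vs" and degree: "degree p \<le> t"
    and far: "enat t < graph_dist (set vs) E (vs ! i) (vs ! j)"
  shows "poly_mat p (adjacency_matrix vs E) $$ (i, j) = 0"
proof -
  have "(adjacency_matrix vs E ^\<^sub>m k) $$ (i, j) = 0" if "k \<le> degree p" for k
  proof (rule ccontr)
    assume "(adjacency_matrix vs E ^\<^sub>m k) $$ (i, j) \<noteq> 0"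
    then have "graph_dist (set vs) E (vs ! i) (vs ! j) \<le> enat k"
      using ij graph_dist_le_of_adjacency_matrix_pow_nonzero by blast
    also have "\<dots> \<le> enat t"
      using that degree by simp
    finally show False using far by simp
  qed
  then show ?thesis
    by (simp add: poly_mat_index[OF adjacency_matrix_carrier ij])
qed

lemma min_diag_le: "i < dim_row M \<Longrightarrow> min_diag M \<le> M $$ (i, i)"
  unfolding min_diag_def by (auto intro!: Min_le)

lemma max_diag_ge: "i < dim_row M \<Longrightarrow> M $$ (i, i) \<le> max_diag M"
  unfolding max_diag_def by (auto intro!: Max_ge)

section \<open>Distance-independent sets and distance edge colourings\<close>

definition distance_independent :: "'a set \<Rightarrow> 'a set set \<Rightarrow> nat \<Rightarrow> 'a set \<Rightarrow> bool" where
  "distance_independent V E t S \<longleftrightarrow>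
     S \<subseteq> V \<and> (\<forall>u\<in>S. \<forall>v\<in>S. u \<noteq> v \<longrightarrow> enat t < graph_dist V E u v)"

theorem card_distance_independent_le:
  fixes p :: "real poly"
  assumes vs: "distinct vs" and S: "distance_independent (set vs) E t S" and degree: "degree p \<le> t"
  defines "A \<equiv> adjacency_matrix vs E"
  shows "card S \<le>
      card {i \<in> {1..length vs}. min_diag (poly_mat p A) \<le> poly p (eigenvalue_list A ! (i - 1))}"
    and "card S \<le>
      card {i \<in> {1..length vs}. poly p (eigenvalue_list A ! (i - 1)) \<le> max_diag (poly_mat p A)}"
proof -
  define I where "I = {i. i < length vs \<and> vs ! i \<in> S}"
  have I: "I \<subseteq> {..<length vs}"
    by (auto simp: I_def)
  have A: "A \<in> carrier_mat (length vs) (length vs)" "A\<^sup>T = A"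
    by (simp_all add: A_def adjacency_matrix_carrier adjacency_matrix_symmetric)
  have "S = (!) vs ` I"
    using S by (auto simp: I_def distance_independent_def in_set_conv_nth subset_iff image_iff)
  moreover have "inj_on ((!) vs) I"
    using vs by (auto simp: inj_on_def I_def nth_eq_iff_index_eq)
  ultimately have card: "card S = card I"
    by (simp add: card_image)
  have off_diag: "poly_mat p A $$ (i, j) = 0" if "i \<in> I" "j \<in> I" "i \<noteq> j" for i j
    unfolding A_def using that vs S degree
    by (intro poly_mat_adjacency_matrix_eq_0)
      (auto simp: I_def distance_independent_def nth_eq_iff_index_eq)
  have diag: "min_diag (poly_mat p A) \<le> poly_mat p A $$ (i, i)"
    "poly_mat p A $$ (i, i) \<le> max_diag (poly_mat p A)" if "i \<in> I" for i
    using that I poly_mat_carrier[OF A(1), of p]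
    by (auto intro!: min_diag_le max_diag_ge simp: subset_iff)
  show "card S \<le>
      card {i \<in> {1..length vs}. min_diag (poly_mat p A) \<le> poly p (eigenvalue_list A ! (i - 1))}"
    unfolding card
    using card_le_poly_eigenvalues_ge_of_diagonal_principal_submatrix[OF A I off_diag diag(1)] .
  show "card S \<le>
      card {i \<in> {1..length vs}. poly p (eigenvalue_list A ! (i - 1)) \<le> max_diag (poly_mat p A)}"
    unfolding card
    using card_le_poly_eigenvalues_le_of_diagonal_principal_submatrix[OF A I off_diag diag(2)] .
qed

lemma distance_chromatic_index_colouring:
  assumes "finite E"
  obtains c :: "'a set \<Rightarrow> nat"
  where "c ` E \<subseteq> {..<distance_chromatic_index E t}" "distance_edge_colouring E t c"
proof -
  obtain f :: "'a set \<Rightarrow> nat" where f: "f ` E = {i. i < card E}" "inj_on f E"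
    using finite_imp_inj_to_nat_seg[OF assms] card_image by (metis card_Collect_less_nat)
  have "\<exists>c :: 'a set \<Rightarrow> nat. c ` E \<subseteq> {..<card E} \<and> distance_edge_colouring E t c"
    using f by (intro exI[of _ f]) (auto simp: distance_edge_colouring_def inj_on_def)
  from LeastI[of "\<lambda>k. \<exists>c :: 'a set \<Rightarrow> nat. c ` E \<subseteq> {..<k} \<and> distance_edge_colouring E t c", OF this]
  show ?thesis
    using that unfolding distance_chromatic_index_def by blast
qed

lemma colour_class_distance_independent:
  "distance_edge_colouring E t c \<Longrightarrow> distance_independent E (line_edges E) t {e \<in> E. c e = k}"
  unfolding distance_edge_colouring_def distance_independent_def edge_dist_def not_le[symmetric]
  by blast

lemma card_le_distance_chromatic_index_mult:
  fixes E :: "'a set set"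
  assumes fin: "finite E"
    and bound: "\<And>S. distance_independent E (line_edges E) t S \<Longrightarrow> card S \<le> N"
  shows "card E \<le> distance_chromatic_index E t * N"
proof -
  let ?k = "distance_chromatic_index E t"
  obtain c :: "'a set \<Rightarrow> nat" where c: "c ` E \<subseteq> {..<?k}" "distance_edge_colouring E t c"
    using distance_chromatic_index_colouring[OF fin] by blast
  have "card E = (\<Sum>k<?k. card {e \<in> E. c e = k})"
    using sum_fun_comp[OF fin _ c(1), of "\<lambda>_. 1 :: nat"] by simp
  also have "\<dots> \<le> ?k * N"
    using sum_bounded_above[of "{..<?k}" "\<lambda>k. card {e \<in> E. c e = k}" N]
      bound colour_class_distance_independent[OF c(2)] by simp
  finally show ?thesis .
qed

theorem theorem3p1:
  fixes V :: "'a set" and E :: "'a set set" and es :: "'a set list"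
    and t :: nat and p :: "real poly"
    and A' :: "real mat" and ev :: "nat \<Rightarrow> real" and W' w' :: real
  assumes graph: "simple_graph V E"
    and nonempty: "E \<noteq> {}"
    and t: "t \<ge> 1"
    and enum: "distinct es" "set es = E"
    and degree: "degree p \<le> t"
  defines "A' \<equiv> adjacency_matrix es (line_edges E)"
    and "ev \<equiv> (\<lambda>i. eigenvalue_list A' ! (i - 1))"
    and "W' \<equiv> max_diag (poly_mat p A')"
    and "w' \<equiv> min_diag (poly_mat p A')"
  shows "real (distance_chromatic_index E t) \<ge>
    real (card E) /
    real (min (card {i \<in> {1..card E}. poly p (ev i) \<ge> w'})
              (card {i \<in> {1..card E}. poly p (ev i) \<le> W'}))"
    (is "_ \<ge> _ / real ?N")
proof -
  have "finite E" and "card E = length es"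
    using enum distinct_card by auto
  then have "card S \<le> ?N" if "distance_independent E (line_edges E) t S" for S
    using card_distance_independent_le[OF enum(1) _ degree] that
    by (simp add: enum(2) A'_def ev_def W'_def w'_def)
  then have "card E \<le> distance_chromatic_index E t * ?N"
    by (intro card_le_distance_chromatic_index_mult[OF \<open>finite E\<close>])
  moreover have "real m / real n \<le> real k" if "m \<le> k * n" for m n k :: nat
    using that by (cases "n = 0") (simp_all add: divide_le_eq flip: of_nat_mult)
  ultimately show ?thesis
    by blast
qed

end
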